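(* Let $0\le v_0<v_1$. Then the function $$\widetilde F(v_0,v_1,C)=\frac{\sqrt{v_0}\sqrt{1-C^2v_0}}{C}+\frac{\arccos(C\sqrt{v_0})}{C^2}+\frac{\sqrt{v_1}\sqrt{1-C^2v_1}}{C}+\frac{\arccos(C\sqrt{v_1})}{C^2}$$ of the variable $C$ is decreasing on the interval $(0,v_1^{-1/2})$. It is locally convex near the point $C=0$ and locally concave near the point $C=v_1^{-1/2}$; that is, there is $\varepsilon>0$ such that it is convex on $(0,\varepsilon)$ and concave on $(v_1^{-1/2}-\varepsilon,v_1^{-1/2})$. *)

theory Defs
  imports "HOL-Analysis.Analysis"
begin

definition F_tilde :: "real \<Rightarrow> real \<Rightarrow> real \<Rightarrow> real" where
  "F_tilde v0 v1 C =
     sqrt v0 * sqrt (1 - C\<^sup>2 * v0) / C + arccos (C * sqrt v0) / C\<^sup>2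
   + sqrt v1 * sqrt (1 - C\<^sup>2 * v1) / C + arccos (C * sqrt v1) / C\<^sup>2"

end

theory Submission
  imports Defs "HOL-Real_Asymp.Real_Asymp"
begin

text \<open>
  Put \<open>k x = x / sqrt (1 - x\<^sup>2) + arccos x\<close>, which is positive on \<open>[0, 1)\<close>. Each of the
  two summands of \<open>F\<close> has first derivative \<open>-2 k(C s) / C ^ 3\<close> and second derivative
  \<open>2 P(C s) / C ^ 4\<close>, where \<open>s = sqrt v\<close> and
  \<open>P x = 3 k x - (x / sqrt (1 - x\<^sup>2)) ^ 3\<close>. So \<open>F\<close> decreases, and the sign of \<open>F''\<close> is that of
  \<open>P (C s\<^sub>0) + P (C s\<^sub>1)\<close>. This sum tends to \<open>3 pi\<close> as \<open>C\<close> tends to \<open>0\<close>. As \<open>C\<close> tends to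
  \<open>1 / s\<^sub>1\<close> it tends to \<open>-\<infinity>\<close>, because \<open>P (C s\<^sub>0)\<close> stays bounded while the cubic term of
  \<open>P (C s\<^sub>1)\<close> dominates.
\<close>

text \<open>With \<open>s\<close> the square root of \<open>v\<close>, the root and the arccos see
  \<open>C\<close> only through \<open>C * s\<close>, so each derivative is a function of
  \<open>C * s\<close> divided by a power of \<open>C\<close>.\<close>

definition F_summand :: "real \<Rightarrow> real \<Rightarrow> real" where
  "F_summand s C = s * sqrt (1 - (C * s)\<^sup>2) / C + arccos (C * s) / C\<^sup>2"

definition slope_factor :: "real \<Rightarrow> real" where
  "slope_factor x = x / sqrt (1 - x\<^sup>2) + arccos x"

definition curvature_factor :: "real \<Rightarrow> real" where
  "curvature_factor x = 3 * slope_factor x - (x / sqrt (1 - x\<^sup>2)) ^ 3"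

lemma F_tilde_eq_summands:
  assumes "0 \<le> v0" "0 \<le> v1"
  shows "F_tilde v0 v1 C = F_summand (sqrt v0) C + F_summand (sqrt v1) C"
  using assms by (simp add: F_tilde_def F_summand_def power_mult_distrib)

text \<open>The quotient is nonnegative but vanishes at 0 (the case \<open>v0 = 0\<close>), so
  strictness comes from \<open>arccos x > arccos 1 = 0\<close>.\<close>

lemma slope_factor_pos:
  assumes "0 \<le> x" "x < 1"
  shows "0 < slope_factor x"
proof -
  have "x\<^sup>2 < 1" using assms by (simp add: abs_square_less_1)
  moreover have "0 < arccos x" using arccos_less_arccos[of x 1] assms by simp
  ultimately show ?thesis using assms by (simp add: slope_factor_def add_nonneg_pos)
qed

text \<open>With \<open>r = sqrt (1 - x\<^sup>2)\<close>, the quotient contributes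
  \<open>1 / r + x\<^sup>2 / r ^ 3\<close> and arccos contributes \<open>- 1 / r\<close>, which
  cancels the first term.\<close>

lemma slope_factor_has_derivative:
  assumes "\<bar>x\<bar> < 1"
  shows "(slope_factor has_real_derivative x\<^sup>2 / sqrt (1 - x\<^sup>2) ^ 3) (at x)"
proof -
  define r where "r = sqrt (1 - x\<^sup>2)"
  have "x\<^sup>2 < 1" using assms by (simp add: abs_square_less_1)
  then have r: "0 < r" by (simp add: r_def)
  have dr: "((\<lambda>x. sqrt (1 - x\<^sup>2)) has_real_derivative - (x / r)) (at x)"
    by (rule DERIV_chain2[OF DERIV_real_sqrt, THEN DERIV_cong])
       (use \<open>x\<^sup>2 < 1\<close> in \<open>auto intro!: derivative_eq_intros simp: r_def divide_simps\<close>)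
  have "(slope_factor has_real_derivative
      (1 * r - x * (- (x / r))) / (r * r) + inverse (- r)) (at x)"
    unfolding slope_factor_def r_def
    by (intro DERIV_add DERIV_divide DERIV_ident DERIV_arccos dr[unfolded r_def])
       (use \<open>x\<^sup>2 < 1\<close> assms in auto)
  also have "(1 * r - x * (- (x / r))) / (r * r) + inverse (- r) = x\<^sup>2 / r ^ 3"
    using r by (simp add: field_simps power2_eq_square power3_eq_cube)
  finally show ?thesis by (simp add: r_def)
qed

lemma F_summand_has_derivative:
  assumes "0 < C" "\<bar>C * s\<bar> < 1"
  shows "(F_summand s has_real_derivative - 2 * slope_factor (C * s) / C ^ 3) (at C)"
proof -
  define r where "r = sqrt (1 - (C * s)\<^sup>2)"
  have "(C * s)\<^sup>2 < 1" using assms by (simp add: abs_square_less_1)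
  then have r: "0 < r" "r\<^sup>2 = 1 - (C * s)\<^sup>2" by (simp_all add: r_def)
  have x: "-1 < C * s" "C * s < 1" using assms by auto
  have dr: "((\<lambda>C. sqrt (1 - (C * s)\<^sup>2)) has_real_derivative - (C * s * s / r)) (at C)"
    by (rule DERIV_chain2[OF DERIV_real_sqrt, THEN DERIV_cong])
       (use \<open>(C * s)\<^sup>2 < 1\<close> in
         \<open>auto intro!: derivative_eq_intros simp: r_def divide_simps power2_eq_square\<close>)
  have da: "((\<lambda>C. arccos (C * s)) has_real_derivative inverse (- r) * s) (at C)"
    unfolding r_def
    by (rule DERIV_chain2[OF DERIV_arccos]) (use x in \<open>auto intro!: derivative_eq_intros\<close>)
  have dC2: "((\<lambda>C. C\<^sup>2) has_real_derivative 2 * C) (at C)"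
    by (auto intro!: derivative_eq_intros)
  have "(F_summand s has_real_derivative
      (s * - (C * s * s / r) * C - s * r * 1) / (C * C) +
      (inverse (- r) * s * C\<^sup>2 - arccos (C * s) * (2 * C)) / (C\<^sup>2 * C\<^sup>2)) (at C)"
    unfolding F_summand_def r_def
    by (intro DERIV_add DERIV_divide DERIV_ident DERIV_cmult dr[unfolded r_def] da[unfolded r_def] dC2)
       (use assms in auto)
  \<comment> \<open>Here \<open>r\<close> is an opaque positive number. The bracket
    \<open>(C * s)\<^sup>2 + r\<^sup>2 + 1\<close> is isolated because the definition of
    \<open>r\<close> then collapses it to 2.\<close>
  also have "(s * - (C * s * s / r) * C - s * r * 1) / (C * C) +
      (inverse (- r) * s * C\<^sup>2 - arccos (C * s) * (2 * C)) / (C\<^sup>2 * C\<^sup>2)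
      = - (s * ((C * s)\<^sup>2 + r\<^sup>2 + 1) / (r * C\<^sup>2)) - 2 * arccos (C * s) / C ^ 3"
    using r(1) assms(1) by (simp add: field_simps power2_eq_square power3_eq_cube)
  also have "\<dots> = - 2 * (C * s / r + arccos (C * s)) / C ^ 3"
    unfolding r(2) using r(1) assms by (simp add: field_simps power2_eq_square power3_eq_cube)
  finally show ?thesis by (simp add: r_def slope_factor_def)
qed

lemma F_summand_has_second_derivative:
  assumes "0 < C" "\<bar>C * s\<bar> < 1"
  shows "((\<lambda>C. - 2 * slope_factor (C * s) / C ^ 3) has_real_derivative
           2 * curvature_factor (C * s) / C ^ 4) (at C)"
proof -
  define r where "r = sqrt (1 - (C * s)\<^sup>2)"
  have "(C * s)\<^sup>2 < 1" using assms by (simp add: abs_square_less_1)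
  then have r: "0 < r" by (simp add: r_def)
  have "((\<lambda>C. slope_factor (C * s)) has_real_derivative (C * s)\<^sup>2 / r ^ 3 * s) (at C)"
    unfolding r_def
    by (rule DERIV_chain2[where g = "\<lambda>C. C * s", OF slope_factor_has_derivative[OF assms(2)]])
       (auto intro!: derivative_eq_intros)
  then have dk: "((\<lambda>C. - 2 * slope_factor (C * s)) has_real_derivative
      - 2 * ((C * s)\<^sup>2 / r ^ 3 * s)) (at C)"
    by (rule DERIV_cmult)
  have dC3: "((\<lambda>C. C ^ 3) has_real_derivative 3 * C\<^sup>2) (at C)"
    by (auto intro!: derivative_eq_intros)
  have "((\<lambda>C. - 2 * slope_factor (C * s) / C ^ 3) has_real_derivative
      (- 2 * ((C * s)\<^sup>2 / r ^ 3 * s) * C ^ 3 - - 2 * slope_factor (C * s) * (3 * C\<^sup>2)) / (C ^ 3 * C ^ 3))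
      (at C)"
    by (rule DERIV_divide[OF dk dC3]) (use assms in simp)
  \<comment> \<open>Expanding the fraction by one factor \<open>C\<close> turns the inner derivative
    \<open>s\<close> into \<open>C * s\<close>; this completes the cube and gives both terms the
    denominator \<open>C ^ 4\<close>.\<close>
  also have "(- 2 * ((C * s)\<^sup>2 / r ^ 3 * s) * C ^ 3 - - 2 * slope_factor (C * s) * (3 * C\<^sup>2)) / (C ^ 3 * C ^ 3)
      = 2 * (3 * slope_factor (C * s) - (C * s / r) ^ 3) / C ^ 4"
    using r assms by (simp add: field_simps power_numeral_reduce)
  finally show ?thesis by (simp add: r_def curvature_factor_def)
qed

lemma continuous_curvature_factor:
  assumes "\<bar>x\<bar> < 1"
  shows "isCont curvature_factor x"
proof -
  have "x\<^sup>2 < 1" using assms by (simp add: abs_square_less_1)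
  then show ?thesis
    unfolding curvature_factor_def
    by (intro continuous_intros DERIV_isCont[OF slope_factor_has_derivative] assms) auto
qed

lemma curvature_factor_0: "curvature_factor 0 = 3 * pi / 2"
  by (simp add: curvature_factor_def slope_factor_def)

text \<open>Bounding arccos by \<open>pi\<close> leaves \<open>3 * u + 3 * pi - u ^ 3\<close> with
  \<open>u = x / sqrt (1 - x\<^sup>2)\<close>, and \<open>u\<close> tends to infinity.\<close>

lemma curvature_factor_at_bot: "filterlim curvature_factor at_bot (at_left 1)"
proof (rule filterlim_at_bot_mono)
  show "LIM x at_left 1. 3 * (x / sqrt (1 - x\<^sup>2)) + 3 * pi - (x / sqrt (1 - x\<^sup>2)) ^ 3 :> at_bot"
    by real_asymp
  show "\<forall>\<^sub>F x in at_left 1. curvature_factor x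
      \<le> 3 * (x / sqrt (1 - x\<^sup>2)) + 3 * pi - (x / sqrt (1 - x\<^sup>2)) ^ 3"
    unfolding eventually_at_left_field
    by (intro exI[of _ 0]) (auto simp: curvature_factor_def slope_factor_def arccos_ubound)
qed

lemma curvature_sum_tendsto_0:
  "((\<lambda>C. curvature_factor (C * s) + curvature_factor (C * t)) \<longlongrightarrow> 3 * pi) (at_right 0)"
proof -
  have "((\<lambda>C. curvature_factor (C * a)) \<longlongrightarrow> 3 * pi / 2) (at_right 0)" for a
  proof -
    have "isCont (\<lambda>C. curvature_factor (C * a)) 0"
      by (rule isCont_o2[of 0 "\<lambda>C. C * a"]) (auto intro: continuous_curvature_factor)
    then show ?thesis
      by (simp add: isCont_def curvature_factor_0 filterlim_at_split)
  qed
  from tendsto_add[OF this this] show ?thesis by simp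
qed

text \<open>Since \<open>s < t\<close>, the limit \<open>s / t\<close> of \<open>C * s\<close> is
  below 1, where \<open>curvature_factor\<close> is continuous, while \<open>C * t\<close> reaches
  the singularity at 1. A convergent summand does not affect the divergence.\<close>

lemma curvature_sum_at_bot:
  assumes "0 \<le> s" "s < t"
  shows "LIM C at_left (1 / t). curvature_factor (C * s) + curvature_factor (C * t) :> at_bot"
proof -
  have t: "0 < t" using assms by simp
  have "isCont (\<lambda>C. curvature_factor (C * s)) (1 / t)"
    by (rule isCont_o2[of "1 / t" "\<lambda>C. C * s"]) (use assms in \<open>auto intro!: continuous_curvature_factor\<close>)
  then have s_lim: "((\<lambda>C. curvature_factor (C * s)) \<longlongrightarrow> curvature_factor (1 / t * s)) (at_left (1 / t))"
    by (simp add: isCont_def filterlim_at_split)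
  \<comment> \<open>The approach to 1 must be from below, since the divergence of
    \<open>curvature_factor\<close> is one-sided.\<close>
  have "filterlim (\<lambda>C. C * t) (at_left 1) (at_left (1 / t))"
    unfolding filterlim_at
  proof
    have "((\<lambda>C. C * t) \<longlongrightarrow> 1 / t * t) (at_left (1 / t))" by (intro tendsto_intros)
    then show "((\<lambda>C. C * t) \<longlongrightarrow> 1) (at_left (1 / t))" using t by simp
    show "\<forall>\<^sub>F C in at_left (1 / t). C * t \<in> {..<1} \<and> C * t \<noteq> 1"
      unfolding eventually_at_left_field
      by (intro exI[of _ 0]) (use t in \<open>auto simp: field_simps\<close>)
  qed
  then have "LIM C at_left (1 / t). curvature_factor (C * t) :> at_bot"
    by (rule filterlim_compose[OF curvature_factor_at_bot])
  then show ?thesis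
    by (simp add: filterlim_tendsto_add_at_bot_iff[OF s_lim])
qed

theorem lemma9:
  fixes v0 v1 :: real
  assumes "0 \<le> v0" and "v0 < v1"
  shows "strict_antimono_on {0<..<v1 powr (-1/2)} (F_tilde v0 v1) \<and>
    (\<exists>\<epsilon>>0. \<epsilon> \<le> v1 powr (-1/2) \<and>
       convex_on {0<..<\<epsilon>} (F_tilde v0 v1) \<and>
       concave_on {v1 powr (-1/2) - \<epsilon><..<v1 powr (-1/2)} (F_tilde v0 v1))"
proof -
  define s t where "s = sqrt v0" and "t = sqrt v1"
  define F' where "F' = (\<lambda>C. - 2 * slope_factor (C * s) / C ^ 3 + - 2 * slope_factor (C * t) / C ^ 3)"
  define F'' where "F'' = (\<lambda>C. 2 * curvature_factor (C * s) / C ^ 4 + 2 * curvature_factor (C * t) / C ^ 4)"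
  have st: "0 \<le> s" "s < t" "0 < t" using assms by (auto simp: s_def t_def)
  have a: "v1 powr (-1/2) = 1 / t"
    using powr_minus_divide[of v1 "1/2"] assms by (simp add: t_def powr_half_sqrt)
  have F: "F_tilde v0 v1 = (\<lambda>C. F_summand s C + F_summand t C)"
    using assms by (intro ext) (simp add: F_tilde_eq_summands s_def t_def)
  have range: "0 \<le> C * s" "C * s < 1" "0 \<le> C * t" "C * t < 1" if "0 < C" "C < 1 / t" for C
  proof -
    show "C * t < 1" using that st by (simp add: field_simps)
    moreover have "C * s \<le> C * t" using that st by simp
    ultimately show "C * s < 1" by simp
  qed (use that st in auto)
  have dF: "(F_tilde v0 v1 has_real_derivative F' C) (at C)" if "0 < C" "C < 1 / t" for C
    unfolding F F'_def
    by (intro DERIV_add F_summand_has_derivative) (use range[OF that] that in auto)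
  have ddF: "(F' has_real_derivative F'' C) (at C)" if "0 < C" "C < 1 / t" for C
    unfolding F'_def F''_def
    by (intro DERIV_add F_summand_has_second_derivative) (use range[OF that] that in auto)
  have F''_eq: "F'' C = 2 * (curvature_factor (C * s) + curvature_factor (C * t)) / C ^ 4" for C
    by (simp add: F''_def add_divide_distrib)

  have F'_neg: "F' C < 0" if "0 < C" "C < 1 / t" for C
    unfolding F'_def
    by (intro add_neg_neg divide_neg_pos mult_neg_pos slope_factor_pos)
       (use range[OF that] that in auto)
  have decreasing: "strict_antimono_on {0<..<1 / t} (F_tilde v0 v1)"
  proof (rule monotone_onI)
    fix x y assume xy: "x \<in> {0<..<1 / t}" "y \<in> {0<..<1 / t}" "x < y"
    \<comment> \<open>The closed interval from \<open>x\<close> to \<open>y\<close> lies inside the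
      open one, so the derivative is negative at its endpoints too.\<close>
    have "\<exists>y. (F_tilde v0 v1 has_real_derivative y) (at C) \<and> y < 0" if "x \<le> C" "C \<le> y" for C
    proof -
      have "0 < C" "C < 1 / t" using that xy by auto
      then show ?thesis using dF F'_neg by blast
    qed
    then show "F_tilde v0 v1 y < F_tilde v0 v1 x"
      using DERIV_neg_imp_decreasing[OF xy(3)] by blast
  qed

  obtain b where b: "0 < b" "\<And>C. 0 < C \<Longrightarrow> C < b \<Longrightarrow> 0 < curvature_factor (C * s) + curvature_factor (C * t)"
  proof -
    have "\<forall>\<^sub>F C in at_right 0. 0 < curvature_factor (C * s) + curvature_factor (C * t)"
      by (rule order_tendstoD(1)[OF curvature_sum_tendsto_0]) simp
    then show ?thesis using that unfolding eventually_at_right_field by blast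
  qed
  obtain c where c: "c < 1 / t" "\<And>C. c < C \<Longrightarrow> C < 1 / t \<Longrightarrow> curvature_factor (C * s) + curvature_factor (C * t) < 0"
  proof -
    \<comment> \<open>Divergence to minus infinity is used only with the threshold 0.\<close>
    have "\<forall>\<^sub>F C in at_left (1 / t). curvature_factor (C * s) + curvature_factor (C * t) < 0"
      using curvature_sum_at_bot[OF st(1,2)] unfolding filterlim_at_bot_dense by blast
    then show ?thesis using that unfolding eventually_at_left_field by blast
  qed
  \<comment> \<open>The entries \<open>b\<close> and \<open>1 / t - c\<close> keep the two intervals
    inside the regions of known sign. Since \<open>c\<close> may be negative, the entry
    \<open>1 / t\<close> keeps the concavity interval within \<open>C > 0\<close>; it also gives the
    required upper bound on \<open>\<epsilon>\<close>.\<close>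
  define \<epsilon> where "\<epsilon> = Min {1 / t, b, 1 / t - c}"
  have \<epsilon>: "0 < \<epsilon>" "\<epsilon> \<le> 1 / t" "\<epsilon> \<le> b" "\<epsilon> \<le> 1 / t - c"
    using b(1) c(1) st by (auto simp: \<epsilon>_def)
  have "convex_on {0<..<\<epsilon>} (F_tilde v0 v1)"
  proof (rule f''_ge0_imp_convex)
    fix C assume "C \<in> {0<..<\<epsilon>}"
    then have C: "0 < C" "C < 1 / t" "C < b" using \<epsilon> by auto
    show "(F_tilde v0 v1 has_real_derivative F' C) (at C)" using dF C by blast
    show "(F' has_real_derivative F'' C) (at C)" using ddF C by blast
    show "0 \<le> F'' C" using b(2)[OF C(1,3)] C(1) by (simp add: F''_eq)
  qed simp
  moreover have "concave_on {1 / t - \<epsilon><..<1 / t} (F_tilde v0 v1)"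
  proof (rule f''_le0_imp_concave)
    fix C assume "C \<in> {1 / t - \<epsilon><..<1 / t}"
    then have C: "0 < C" "C < 1 / t" "c < C" using \<epsilon> by auto
    show "(F_tilde v0 v1 has_real_derivative F' C) (at C)" using dF C by blast
    show "(F' has_real_derivative F'' C) (at C)" using ddF C by blast
    show "F'' C \<le> 0" using c(2)[OF C(3,2)] C(1) by (simp add: F''_eq divide_nonpos_pos)
  qed simp
  ultimately show ?thesis unfolding a using decreasing \<epsilon>(1,2) by blast
qed

end
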